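(* For all positive integers $n,m$, the second player wins the Peaceable Bishops Game $\mathrm{PB}(n,m)$ if and only if at least one of $n$ and $m$ is even.
   Context: The Peaceable Bishops Game $\mathrm{PB}(n,m)$ is played on an $n\times m$ chessboard with squares $(x,y)$, $0\leq x\leq n-1$, $0\leq y\leq m-1$. Two players alternately place a bishop on an unoccupied square; the first player places white bishops and the second player places black bishops. A player may not place a bishop on a square within attacking range of a bishop previously placed by the opponent. A player unable to move on their turn loses. Two distinct squares $(x_1,y_1)$ and $(x_2,y_2)$ are within attacking range for bishops iff $|x_1-x_2|=|y_1-y_2|$ (regardless of any pieces standing between them). A player "wins" the game if that player has a winning strategy. *)

theory Defs
  imports Main
begin

type_synonym square = "nat \<times> nat"

datatype player = First | Second

fun opponent :: "player \<Rightarrow> player" where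
  "opponent First = Second"
| "opponent Second = First"

definition board :: "nat \<Rightarrow> nat \<Rightarrow> square set" where
  "board n m = {(x, y). x < n \<and> y < m}"

(* The coordinates are cast to int because subtraction on nat truncates. *)
definition attacks :: "square \<Rightarrow> square \<Rightarrow> bool" where
  "attacks s t \<longleftrightarrow> s \<noteq> t \<and>
     \<bar>int (fst s) - int (fst t)\<bar> = \<bar>int (snd s) - int (snd t)\<bar>"

(* A history is the chronological list of the squares chosen so far. Move number i (counted
   from 0) was made by First if i is even and by Second if i is odd, so that the history
   determines the position, including the colours of the bishops and the player to move. *)
type_synonym history = "square list"

definition mover :: "nat \<Rightarrow> player" where
  "mover i = (if even i then First else Second)"

definition to_move :: "history \<Rightarrow> player" where
  "to_move h = mover (length h)"

definition bishops :: "player \<Rightarrow> history \<Rightarrow> square set" where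
  "bishops p h = {h ! i | i. i < length h \<and> mover i = p}"

definition legal_move :: "nat \<Rightarrow> nat \<Rightarrow> history \<Rightarrow> square \<Rightarrow> bool" where
  "legal_move n m h s \<longleftrightarrow> s \<in> board n m \<and> s \<notin> set h \<and>
     (\<forall>t \<in> bishops (opponent (to_move h)) h. \<not> attacks t s)"

definition legal_history :: "nat \<Rightarrow> nat \<Rightarrow> history \<Rightarrow> bool" where
  "legal_history n m h \<longleftrightarrow> (\<forall>i < length h. legal_move n m (take i h) (h ! i))"

definition complete_play :: "nat \<Rightarrow> nat \<Rightarrow> history \<Rightarrow> bool" where
  "complete_play n m h \<longleftrightarrow> legal_history n m h \<and> (\<nexists>s. legal_move n m h s)"

definition loser :: "history \<Rightarrow> player" where
  "loser h = to_move h"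

(* A strategy must supply a legal move in every legal history in which its player is on turn
   and able to move; elsewhere its value is irrelevant. Without this requirement a strategy
   suggesting illegal moves would win vacuously. *)
definition is_strategy :: "nat \<Rightarrow> nat \<Rightarrow> player \<Rightarrow> (history \<Rightarrow> square) \<Rightarrow> bool" where
  "is_strategy n m p \<sigma> \<longleftrightarrow>
     (\<forall>h. legal_history n m h \<and> to_move h = p \<and> (\<exists>s. legal_move n m h s)
          \<longrightarrow> legal_move n m h (\<sigma> h))"

definition follows :: "player \<Rightarrow> (history \<Rightarrow> square) \<Rightarrow> history \<Rightarrow> bool" where
  "follows p \<sigma> h \<longleftrightarrow> (\<forall>i < length h. mover i = p \<longrightarrow> h ! i = \<sigma> (take i h))"

(* Squares are never reused, so every play ends after at most n * m moves, and it suffices to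
   consider complete plays. *)
definition winning_strategy :: "nat \<Rightarrow> nat \<Rightarrow> player \<Rightarrow> (history \<Rightarrow> square) \<Rightarrow> bool" where
  "winning_strategy n m p \<sigma> \<longleftrightarrow> is_strategy n m p \<sigma> \<and>
     (\<forall>h. complete_play n m h \<and> follows p \<sigma> h \<longrightarrow> loser h = opponent p)"

definition wins_PB :: "nat \<Rightarrow> nat \<Rightarrow> player \<Rightarrow> bool" where
  "wins_PB n m p \<longleftrightarrow> (\<exists>\<sigma>. winning_strategy n m p \<sigma>)"

end

theory Submission
  imports Defs
begin

text \<open>
  Both directions are mirroring arguments. If, say, \<open>n\<close> is even, Second answers every move with
  its reflection \<open>(x, y) \<mapsto> (n - 1 - x, y)\<close>: a square and its image lie in the same row at an odd
  distance, so they are distinct and do not attack each other. If both sides are odd, First opens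
  in the centre and then answers with the half-turn about it: a square and its image attack each
  other only on the diagonals through the centre, which are closed to Second by the opening.
\<close>

section \<open>Effect of appending one move to a history\<close>

lemma to_move_Nil [simp]: "to_move [] = First"
  by (simp add: to_move_def mover_def)

lemma to_move_snoc [simp]: "to_move (h @ [s]) = opponent (to_move h)"
  by (simp add: to_move_def mover_def)

lemma opponent_opponent [simp]: "opponent (opponent p) = p"
  by (cases p) auto

lemma opponent_inject [simp]: "opponent p = opponent q \<longleftrightarrow> p = q"
  by (cases p; cases q) auto

lemma opponent_neq [simp]: "opponent p \<noteq> p" "p \<noteq> opponent p"
  by (cases p; simp)+

lemma neq_opponent_iff: "p \<noteq> q \<longleftrightarrow> p = opponent q"
  by (cases p; cases q) auto

lemma bishops_Nil [simp]: "bishops p [] = {}"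
  by (simp add: bishops_def)

lemma bishops_snoc [simp]:
  "bishops p (h @ [s]) = (if to_move h = p then insert s (bishops p h) else bishops p h)"
proof -
  have "{i. i < length (h @ [s]) \<and> mover i = p} = {i. i < length h \<and> mover i = p} \<union>
      (if to_move h = p then {length h} else {})"
    by (auto simp: to_move_def less_Suc_eq)
  moreover have "bishops p g = (!) g ` {i. i < length g \<and> mover i = p}" for g
    unfolding bishops_def by blast
  moreover have "(!) (h @ [s]) ` {i. i < length h \<and> mover i = p}
      = (!) h ` {i. i < length h \<and> mover i = p}"
    by (rule image_cong) (auto simp: nth_append)
  ultimately show ?thesis by (simp add: image_Un)
qed

lemma set_eq_bishops: "set h = bishops p h \<union> bishops (opponent p) h"
  by (induction h rule: rev_induct) (auto simp: neq_opponent_iff)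

lemma legal_history_Nil [simp]: "legal_history n m []"
  by (simp add: legal_history_def)

lemma legal_history_snoc [simp]:
  "legal_history n m (h @ [s]) \<longleftrightarrow> legal_history n m h \<and> legal_move n m h s"
  by (auto simp: legal_history_def nth_append less_Suc_eq)

lemma follows_Nil [simp]: "follows p \<sigma> []"
  by (simp add: follows_def)

lemma follows_snoc [simp]:
  "follows p \<sigma> (h @ [s]) \<longleftrightarrow> follows p \<sigma> h \<and> (to_move h = p \<longrightarrow> s = \<sigma> h)"
  by (auto simp: follows_def to_move_def nth_append less_Suc_eq)

lemma legal_history_distinct: "legal_history n m h \<Longrightarrow> distinct h \<and> set h \<subseteq> board n m"
  by (induction h rule: rev_induct) (auto simp: legal_move_def)

section \<open>Finiteness of play, and at most one winner\<close>

lemma finite_board: "finite (board n m)"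
proof -
  have "board n m = {..<n} \<times> {..<m}" by (auto simp: board_def)
  then show ?thesis by simp
qed

text \<open>Squares are never reused, so legal histories are duplicate-free lists over a finite
  board.\<close>

lemma finite_legal_histories: "finite {h. legal_history n m h}"
  by (rule finite_subset[OF _ finite_subset_distinct[OF finite_board[of n m]]])
    (use legal_history_distinct in blast)

text \<open>Let the two winning strategies play each other. A longest legal history that follows
  both is complete, and its loser would have to be both players.\<close>

lemma not_both_win:
  assumes "wins_PB n m First" "wins_PB n m Second"
  shows False
proof -
  obtain \<sigma> \<tau> where \<sigma>: "winning_strategy n m First \<sigma>" and \<tau>: "winning_strategy n m Second \<tau>"
    using assms by (auto simp: wins_PB_def)
  define H where "H = {h. legal_history n m h \<and> follows First \<sigma> h \<and> follows Second \<tau> h}"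
  have "finite H" "[] \<in> H"
    using finite_legal_histories[of n m] by (auto simp: H_def)
  \<comment> \<open>\<open>arg_max_nat_lemma\<close> asks for a strict bound on the lengths, hence
    the \<open>Suc\<close> around the maximum.\<close>
  then obtain h where h: "h \<in> H" and longest: "\<And>g. g \<in> H \<Longrightarrow> length g \<le> length h"
    using arg_max_nat_lemma[of "\<lambda>h. h \<in> H" "[]" length "Suc (Max (length ` H))"]
    by (auto simp: less_Suc_eq_le)
  have "\<nexists>s. legal_move n m h s"
  proof
    assume "\<exists>s. legal_move n m h s"
    then have "legal_move n m h (if to_move h = First then \<sigma> h else \<tau> h)"
      using h \<sigma> \<tau> by (auto simp: H_def winning_strategy_def is_strategy_def neq_opponent_iff)
    then have "h @ [if to_move h = First then \<sigma> h else \<tau> h] \<in> H"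
      using h by (auto simp: H_def)
    from longest[OF this] show False by simp
  qed
  then have "complete_play n m h"
    using h by (simp add: H_def complete_play_def)
  then have "loser h = Second" "loser h = First"
    using h \<sigma> \<tau> by (auto simp: H_def winning_strategy_def)
  then show False by simp
qed

section \<open>The mirroring strategy\<close>

text \<open>At the turn of the mirroring player, \<open>last h\<close> is the opponent's latest
  move. The \<open>SOME\<close> fallback makes this a strategy in the sense of
  \<open>is_strategy\<close> for any \<open>\<phi>\<close> and \<open>c\<close>.\<close>

definition mirror_strategy ::
    "nat \<Rightarrow> nat \<Rightarrow> (square \<Rightarrow> square) \<Rightarrow> square \<Rightarrow> history \<Rightarrow> square" where
  "mirror_strategy n m \<phi> c h =
     (let s = if h = [] then c else \<phi> (last h)
      in if legal_move n m h s then s else SOME s. legal_move n m h s)"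

text \<open>The square \<open>c\<close> is the opening move of First; it plays no role if \<open>p = Second\<close>.\<close>

locale mirroring =
  fixes n m :: nat and p :: player and \<phi> :: "square \<Rightarrow> square" and c :: square
  assumes mirror_board: "s \<in> board n m \<Longrightarrow> \<phi> s \<in> board n m"
    and mirror_mirror: "s \<in> board n m \<Longrightarrow> \<phi> (\<phi> s) = s"
    and mirror_attacks:
      "s \<in> board n m \<Longrightarrow> t \<in> board n m \<Longrightarrow> attacks (\<phi> s) (\<phi> t) \<longleftrightarrow> attacks s t"
    and centre: "p = First \<Longrightarrow> c \<in> board n m \<and> \<phi> c = c"
    and mirror_apart: "s \<in> board n m \<Longrightarrow> (p = First \<Longrightarrow> s \<noteq> c \<and> \<not> attacks c s)
      \<Longrightarrow> \<phi> s \<noteq> s \<and> \<not> attacks s (\<phi> s)"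
begin

abbreviation "\<sigma> \<equiv> mirror_strategy n m \<phi> c"

definition mirrored :: "history \<Rightarrow> bool" where
  "mirrored h \<longleftrightarrow> \<phi> ` bishops (opponent p) h \<subseteq> bishops p h \<and>
     bishops p h \<subseteq> \<phi> ` bishops (opponent p) h \<union> {s. \<phi> s = s} \<and>
     (p = First \<longrightarrow> c \<in> bishops p h)"

lemma is_strategy_mirror: "is_strategy n m q \<sigma>"
  unfolding is_strategy_def mirror_strategy_def Let_def by (auto intro: someI)

lemma centre_legal: "p = First \<Longrightarrow> legal_move n m [] c"
  using centre by (simp add: legal_move_def)

text \<open>Any obstacle to the reply \<open>\<phi> s\<close> reflects to an obstacle to
  \<open>s\<close> itself, except for a clash between \<open>s\<close> and \<open>\<phi> s\<close>,
  which \<open>mirror_apart\<close> rules out.\<close>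

lemma mirror_legal:
  assumes g: "legal_history n m g" "to_move g = opponent p" "mirrored g"
    and s: "legal_move n m g s"
  shows "legal_move n m (g @ [s]) (\<phi> s)"
proof -
  have on_board: "set g \<subseteq> board n m"
    using legal_history_distinct g(1) by blast
  have sb: "s \<in> board n m" and new: "s \<notin> set g"
    and safe: "\<And>t. t \<in> bishops p g \<Longrightarrow> \<not> attacks t s"
    using s g(2) by (auto simp: legal_move_def)
  note set_g = set_eq_bishops[of g p]
  \<comment> \<open>If \<open>p = First\<close>, the bishop on \<open>c\<close> belongs to
    \<open>p\<close>, so the legality of \<open>s\<close> supplies the premise of
    \<open>mirror_apart\<close>.\<close>
  have apart: "\<phi> s \<noteq> s" "\<not> attacks s (\<phi> s)"
    using mirror_apart[OF sb] g(3) new safe set_g unfolding mirrored_def by blast+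
  have "\<phi> s \<notin> bishops (opponent p) g"
  proof
    assume "\<phi> s \<in> bishops (opponent p) g"
    then have "\<phi> (\<phi> s) \<in> bishops p g"
      using g(3) unfolding mirrored_def by blast
    then show False using mirror_mirror[OF sb] new set_g by auto
  qed
  moreover have "\<phi> s \<notin> bishops p g"
  proof
    assume "\<phi> s \<in> bishops p g"
    then consider t where "t \<in> bishops (opponent p) g" "\<phi> s = \<phi> t" | "\<phi> (\<phi> s) = \<phi> s"
      using g(3) unfolding mirrored_def by blast
    then show False
    proof cases
      case 1
      then have "s = t" using mirror_mirror sb on_board set_g by (metis UnCI subsetD)
      then show False using 1 new set_g by auto
    next
      case 2
      then show False using mirror_mirror[OF sb] apart by simp
    qed
  qed
  moreover have "\<not> attacks t (\<phi> s)" if "t \<in> bishops (opponent p) g" for t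
  proof -
    have "\<phi> t \<in> bishops p g" and tb: "t \<in> board n m"
      using that g(3) on_board set_g unfolding mirrored_def by auto
    \<comment> \<open>\<open>\<phi> (\<phi> s)\<close> is \<open>s\<close>, which the bishop of
      \<open>p\<close> on \<open>\<phi> t\<close> cannot attack.\<close>
    then have "\<not> attacks (\<phi> t) (\<phi> (\<phi> s))"
      using safe mirror_mirror[OF sb] by simp
    then show ?thesis using mirror_attacks tb mirror_board sb by blast
  qed
  ultimately show ?thesis
    using apart mirror_board[OF sb] set_g g(2) by (auto simp: legal_move_def)
qed

text \<open>The invariant is restored after a full round, so the induction on length removes two
  moves at once: the reply and the move it answers. A history of one move is the opening on
  \<open>c\<close>.\<close>

lemma mirrored_if_opponent_to_move:
  assumes "legal_history n m h" "follows p \<sigma> h" "to_move h = opponent p"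
  shows "mirrored h"
  using assms
proof (induction h rule: length_induct)
  case (1 h)
  note IH = 1(1)[rule_format] and legal = 1(2) and fol = 1(3) and turn = 1(4)
  show ?case
  proof (cases h rule: rev_cases)
    case Nil
    then show ?thesis using turn unfolding mirrored_def by (cases p) auto
  next
    case h: (snoc g r)
    then have g_turn: "to_move g = p" and g_legal: "legal_history n m g"
      and g_fol: "follows p \<sigma> g" and reply: "r = \<sigma> g"
      using legal fol turn by auto
    show ?thesis
    proof (cases g rule: rev_cases)
      case Nil
      then have p: "p = First" and "r = \<sigma> []"
        using g_turn reply by auto
      then have "r = c" using centre_legal by (simp add: mirror_strategy_def)
      then have "bishops p h = {c}" "bishops (opponent p) h = {}"
        using h Nil p bishops_snoc[of _ "[]"] by auto
      then show ?thesis using centre p unfolding mirrored_def by simp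
    next
      case g: (snoc f s)
      have f_turn: "to_move f = opponent p"
        using g_turn unfolding g by auto
      have f: "legal_history n m f" "legal_move n m f s" "mirrored f"
        using IH[of f] g_legal g_fol f_turn h g by auto
      note reply
      also have "\<sigma> g = \<phi> s"
        using mirror_legal[OF f(1) f_turn f(3,2)] g by (simp add: mirror_strategy_def)
      finally have "bishops p h = insert (\<phi> s) (bishops p f)"
        "bishops (opponent p) h = insert s (bishops (opponent p) f)"
        \<comment> \<open>\<open>bishops_snoc\<close> needs the form \<open>(f @ [s]) @ [r]\<close>,
          which \<open>append_assoc\<close> would destroy.\<close>
        using h g f_turn by (simp_all del: append_assoc)
      then show ?thesis
        using f(3) unfolding mirrored_def by auto
    qed
  qed
qed

text \<open>If \<open>p\<close> were stuck, the last move would be the opponent's and its mirror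
  image would still be legal; on the empty board the opening \<open>c\<close> is.\<close>

lemma mirror_wins: "wins_PB n m p"
proof -
  have "loser h = opponent p" if "complete_play n m h" "follows p \<sigma> h" for h
  proof (rule ccontr)
    assume "loser h \<noteq> opponent p"
    then have turn: "to_move h = p" by (simp add: loser_def neq_opponent_iff)
    have legal: "legal_history n m h" and stuck: "\<And>s. \<not> legal_move n m h s"
      using that by (auto simp: complete_play_def)
    show False
    proof (cases h rule: rev_cases)
      case Nil
      then show False using turn centre_legal stuck by auto
    next
      case h: (snoc g s)
      have g: "legal_history n m g" "legal_move n m g s" "follows p \<sigma> g"
        using h legal that(2) by auto
      have "to_move g = opponent p" using turn h by auto
      then show False
        using mirror_legal mirrored_if_opponent_to_move g stuck h by blast
    qed
  qed
  then show ?thesis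
    using is_strategy_mirror unfolding wins_PB_def winning_strategy_def by blast
qed

end

section \<open>Reflections and the half-turn of the board\<close>

lemma reflect_dist:
  fixes x x' n :: nat
  assumes "x < n" "x' < n"
  shows "\<bar>int (n - Suc x) - int (n - Suc x')\<bar> = \<bar>int x - int x'\<bar>"
  using assms by (simp add: of_nat_diff)

lemma reflect_eq_iff:
  fixes x x' n :: nat
  assumes "x < n" "x' < n"
  shows "n - Suc x = n - Suc x' \<longleftrightarrow> x = x'"
  using assms by auto

lemma Second_wins_even_width:
  assumes "even n"
  shows "wins_PB n m Second"
proof -
  interpret mirroring n m Second "\<lambda>(x, y). (n - Suc x, y)" "(0, 0)"
  proof
    fix s assume "s \<in> board n m"
    then show "(case s of (x, y) \<Rightarrow> (n - Suc x, y)) \<noteq> s \<and>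
        \<not> attacks s (case s of (x, y) \<Rightarrow> (n - Suc x, y))"
      \<comment> \<open>The row is unchanged, so both claims come down to
        \<open>x \<noteq> n - Suc x\<close>, which is the parity of \<open>n\<close>.\<close>
      using assms by (auto simp: board_def attacks_def split: prod.splits) presburger
  qed (auto simp: board_def attacks_def reflect_dist reflect_eq_iff)
  show ?thesis by (rule mirror_wins)
qed

lemma Second_wins_even_height:
  assumes "even m"
  shows "wins_PB n m Second"
proof -
  interpret mirroring n m Second "\<lambda>(x, y). (x, m - Suc y)" "(0, 0)"
  proof
    fix s assume "s \<in> board n m"
    then show "(case s of (x, y) \<Rightarrow> (x, m - Suc y)) \<noteq> s \<and>
        \<not> attacks s (case s of (x, y) \<Rightarrow> (x, m - Suc y))"
      using assms by (auto simp: board_def attacks_def split: prod.splits) presburger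
  qed (auto simp: board_def attacks_def reflect_dist reflect_eq_iff)
  show ?thesis by (rule mirror_wins)
qed

lemma First_wins_odd:
  assumes "odd n" "odd m"
  shows "wins_PB n m First"
proof -
  obtain a b where ab: "n = 2 * a + 1" "m = 2 * b + 1"
    using assms by (meson oddE)
  interpret mirroring n m First "\<lambda>(x, y). (n - Suc x, m - Suc y)" "(a, b)"
  proof
    fix s assume s: "s \<in> board n m" "First = First \<Longrightarrow> s \<noteq> (a, b) \<and> \<not> attacks (a, b) s"
    obtain x y where xy: "s = (x, y)" by (cases s)
    \<comment> \<open>Equality would put \<open>s\<close> at the centre or on a diagonal through
      it.\<close>
    have "\<bar>int x - int a\<bar> \<noteq> \<bar>int y - int b\<bar>"
      using s(2) by (auto simp: xy attacks_def abs_minus_commute)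
    \<comment> \<open>The centre is the midpoint of \<open>s\<close> and its image, so the offsets
      from the centre double.\<close>
    moreover have "int x - int (n - Suc x) = 2 * (int x - int a)"
      "int y - int (m - Suc y) = 2 * (int y - int b)"
      using s(1) ab by (auto simp: xy board_def of_nat_diff)
    ultimately have "\<bar>int x - int (n - Suc x)\<bar> \<noteq> \<bar>int y - int (m - Suc y)\<bar>"
      by (simp add: abs_mult)
    then show "(case s of (x, y) \<Rightarrow> (n - Suc x, m - Suc y)) \<noteq> s \<and>
        \<not> attacks s (case s of (x, y) \<Rightarrow> (n - Suc x, m - Suc y))"
      by (auto simp: xy attacks_def)
  next
    show "(a, b) \<in> board n m \<and>
        (case (a, b) of (x, y) \<Rightarrow> (n - Suc x, m - Suc y)) = (a, b)"
      by (simp add: ab board_def)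
  next
    fix s t assume "s \<in> board n m" "t \<in> board n m"
    then show "attacks (case s of (x, y) \<Rightarrow> (n - Suc x, m - Suc y))
        (case t of (x, y) \<Rightarrow> (n - Suc x, m - Suc y)) \<longleftrightarrow> attacks s t"
      by (cases s; cases t)
        (simp add: board_def attacks_def reflect_dist reflect_eq_iff abs_minus_commute)
  qed (auto simp: board_def)
  show ?thesis by (rule mirror_wins)
qed

theorem theorem5p3:
  fixes n m :: nat
  assumes "n > 0" and "m > 0"
  shows "wins_PB n m Second \<longleftrightarrow> even n \<or> even m"
proof
  assume "wins_PB n m Second"
  \<comment> \<open>On a board with both sides odd First would win as well.\<close>
  then have "\<not> wins_PB n m First" using not_both_win by auto
  then show "even n \<or> even m" using First_wins_odd by auto
next
  assume "even n \<or> even m"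
  then show "wins_PB n m Second"
    by (elim disjE) (rule Second_wins_even_width Second_wins_even_height, assumption)+
qed

end
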